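(* Let $S$ be a $\mathrm{Cu}$-semigroup satisfying (O5). Let $K$ be a subset of $F(S)$, and let $\mu\in F(S)$. The following are equivalent: (i) The element $\mu$ belongs to the closed cone generated by $K\cup\{0\}$, i.e. to the closure in $F(S)$ of $\{t_1\lambda_1+\dots+t_n\lambda_n : t_j\in(0,\infty),\ \lambda_j\in K\cup\{0\}\}$. (ii) For all $x,y',y\in S$ with $\widehat x|_K\le\widehat{y'}|_K$ and $y'\ll y$, we have $\widehat x(\mu)\le\widehat y(\mu)$. (iii) For all $x',x,y',y\in S$ and $\gamma\in(0,1)$ satisfying $x'\ll x$, $\widehat x|_K\le\gamma\widehat{y'}|_K$ and $y'\ll y$, we have $\widehat{x'}(\mu)\le\widehat y(\mu)$.
   Context: A $\mathrm{Cu}$-semigroup is a commutative, partially ordered monoid $S$ (order compatible with addition) with $0\le x$ for all $x$, such that: (O1) every increasing sequence has a supremum; (O2) every $x\in S$ is the supremum of a sequence $(x_n)_n$ with $x_n\ll x_{n+1}$ for all $n$; (O3) $x_1\ll x_2$ and $y_1\ll y_2$ imply $x_1+y_1\ll x_2+y_2$; (O4) $\sup_n(x_n+y_n)=\sup_nx_n+\sup_ny_n$ for increasing sequences. Here $x\ll y$ means: for every increasing sequence $(y_n)_n$ with $y\le\sup_ny_n$ there is $n$ with $x\le y_n$. (O5): for all $x'\ll x\le y$ there is $z$ with $x'+z\le y\le x+z$; moreover, if $x+w\le y$ and $w'\ll w$, then $z$ may be chosen with $w'\ll z$. A functional on $S$ is an order-preserving monoid homomorphism $\lambda\colon S\to[0,\infty]$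 preserving suprema of increasing sequences. $F(S)$ is the set of functionals, with pointwise addition and pointwise multiplication by scalars in $(0,\infty)$, endowed with the compact Hausdorff topology in which a net $\lambda_j\to\lambda$ iff $\limsup_j\lambda_j(x')\le\lambda(x)\le\liminf_j\lambda_j(x)$ for all $x'\ll x$ in $S$. For $x\in S$, $\widehat x\colon F(S)\to[0,\infty]$ is $\widehat x(\lambda)=\lambda(x)$. $0\in F(S)$ is the zero functional. *)

theory Defs
  imports "HOL-Library.Extended_Nonnegative_Real" "HOL-Analysis.Abstract_Limits"
begin

(* Inside the class context the library's incseq is not available; outside of it the
   premise "monotone (\<le>) (\<le>) X" is literally "incseq X". *)

context order
begin

definition seq_sup :: "(nat \<Rightarrow> 'a) \<Rightarrow> 'a \<Rightarrow> bool"
  where "seq_sup X s \<longleftrightarrow> (\<forall>n. X n \<le> s) \<and> (\<forall>u. (\<forall>n. X n \<le> u) \<longrightarrow> s \<le> u)"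

definition way_below :: "'a \<Rightarrow> 'a \<Rightarrow> bool"  (infix \<open>\<lless>\<close> 50)
  where "x \<lless> y \<longleftrightarrow>
    (\<forall>Y s. monotone (\<le>) (\<le>) Y \<longrightarrow> seq_sup Y s \<longrightarrow> y \<le> s \<longrightarrow> (\<exists>n. x \<le> Y n))"

end

class cu_semigroup = ordered_comm_monoid_add +
  assumes cu_zero_le: "0 \<le> x"
    and O1: "monotone (\<le>) (\<le>) X \<Longrightarrow> \<exists>s. seq_sup X s"
    and O2: "\<exists>X. (\<forall>n. X n \<lless> X (Suc n)) \<and> seq_sup X x"
    and O3: "x1 \<lless> x2 \<Longrightarrow> y1 \<lless> y2 \<Longrightarrow> x1 + y1 \<lless> x2 + y2"
    and O4: "monotone (\<le>) (\<le>) X \<Longrightarrow> monotone (\<le>) (\<le>) Y \<Longrightarrow>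
      seq_sup X s \<Longrightarrow> seq_sup Y t \<Longrightarrow> seq_sup (\<lambda>n. X n + Y n) (s + t)"

class cu_semigroup_O5 = cu_semigroup +
  assumes O5: "x' \<lless> x \<Longrightarrow> x \<le> y \<Longrightarrow> \<exists>z. x' + z \<le> y \<and> y \<le> x + z"
    and O5_refined: "x' \<lless> x \<Longrightarrow> x \<le> y \<Longrightarrow> x + w \<le> y \<Longrightarrow> w' \<lless> w \<Longrightarrow>
      \<exists>z. x' + z \<le> y \<and> y \<le> x + z \<and> w' \<lless> z"

definition functionals :: "('a::cu_semigroup \<Rightarrow> ennreal) set"
  where "functionals = {l. mono l \<and> l 0 = 0 \<and> (\<forall>x y. l (x + y) = l x + l y) \<and>
    (\<forall>X s. incseq X \<longrightarrow> seq_sup X s \<longrightarrow> l s = (SUP n. l (X n)))}"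

definition functional_conv ::
    "('i \<Rightarrow> 'a::cu_semigroup \<Rightarrow> ennreal) \<Rightarrow> ('a \<Rightarrow> ennreal) \<Rightarrow> 'i filter \<Rightarrow> bool"
  where "functional_conv f l F \<longleftrightarrow>
    (\<forall>x' x. x' \<lless> x \<longrightarrow>
      Limsup F (\<lambda>i. f i x') \<le> l x \<and> l x \<le> Liminf F (\<lambda>i. f i x))"

(* A set of functionals is open iff every net (here: filter) of functionals converging to a
   point of it is eventually in it. That the convergence of this topology is exactly
   functional_conv is limitin_functional_topology below; this determines the topology. *)

definition functional_topology :: "('a::cu_semigroup \<Rightarrow> ennreal) topology"
  where "functional_topology = topology (\<lambda>U. U \<subseteq> functionals \<and>
    (\<forall>l\<in>U. \<forall>F. (\<forall>\<^sub>F m in F. m \<in> functionals) \<longrightarrow> functional_conv (\<lambda>m. m) l F \<longrightarrow>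
      (\<forall>\<^sub>F m in F. m \<in> U)))"

definition generated_cone :: "('a::cu_semigroup \<Rightarrow> ennreal) set \<Rightarrow> ('a \<Rightarrow> ennreal) set"
  where "generated_cone A = {(\<lambda>x. \<Sum>j<n. ennreal (t j) * l j x) | (n::nat) (t::nat \<Rightarrow> real) l.
    1 \<le> n \<and> (\<forall>j<n. 0 < t j \<and> l j \<in> A)}"

lemma openin_functional_topology:
  fixes U :: "('a::cu_semigroup \<Rightarrow> ennreal) set"
  shows "openin functional_topology U \<longleftrightarrow> U \<subseteq> functionals \<and>
    (\<forall>l\<in>U. \<forall>F. (\<forall>\<^sub>F m in F. m \<in> functionals) \<longrightarrow> functional_conv (\<lambda>m. m) l F \<longrightarrow>
      (\<forall>\<^sub>F m in F. m \<in> U))"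
proof -
  have "istopology (\<lambda>U :: ('a \<Rightarrow> ennreal) set. U \<subseteq> functionals \<and>
    (\<forall>l\<in>U. \<forall>F. (\<forall>\<^sub>F m in F. m \<in> functionals) \<longrightarrow> functional_conv (\<lambda>m. m) l F \<longrightarrow>
      (\<forall>\<^sub>F m in F. m \<in> U)))"
    (is "istopology ?open")
    unfolding istopology_def
  proof (rule conjI; intro allI impI)
    fix U V assume "?open U" "?open V"
    then show "?open (U \<inter> V)"
      by (auto simp: eventually_conj_iff)
  next
    fix \<U> assume \<U>: "\<forall>U\<in>\<U>. ?open U"
    show "?open (\<Union>\<U>)"
    proof (intro conjI ballI allI impI)
      show "\<Union>\<U> \<subseteq> functionals" using \<U> by (simp add: Sup_le_iff)
      fix l F assume l: "l \<in> \<Union>\<U>" and F: "\<forall>\<^sub>F m in F. m \<in> functionals"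
        and conv: "functional_conv (\<lambda>m. m) l F"
      obtain U where U: "U \<in> \<U>" "l \<in> U" using l by (rule UnionE)
      then have "\<forall>\<^sub>F m in F. m \<in> U" using \<U> F conv by simp
      then show "\<forall>\<^sub>F m in F. m \<in> \<Union>\<U>" using U(1) by (auto elim: eventually_mono)
    qed
  qed
  then show ?thesis
    unfolding functional_topology_def by (simp only: topology_inverse')
qed

lemma topspace_functional_topology [simp]:
  "topspace functional_topology = (functionals :: ('a::cu_semigroup \<Rightarrow> ennreal) set)"
proof
  show "topspace functional_topology \<subseteq> (functionals :: ('a \<Rightarrow> ennreal) set)"
    using openin_functional_topology[THEN iffD1, OF openin_topspace] by (rule conjunct1)
  have "openin functional_topology (functionals :: ('a \<Rightarrow> ennreal) set)"
    by (auto simp: openin_functional_topology)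
  then show "(functionals :: ('a \<Rightarrow> ennreal) set) \<subseteq> topspace functional_topology"
    by (rule openin_subset)
qed

lemma way_below_trans_le:
  fixes x :: "'a::order"
  assumes "x \<lless> y" "y \<le> z" shows "x \<lless> z"
  using assms unfolding way_below_def by (meson order_trans)

lemma le_trans_way_below:
  fixes x :: "'a::order"
  assumes "x \<le> y" "y \<lless> z" shows "x \<lless> z"
  using assms unfolding way_below_def by (meson order_trans)

lemma way_below_imp_le:
  fixes x :: "'a::order"
  assumes "x \<lless> y" shows "x \<le> y"
proof -
  have "mono (\<lambda>n::nat. y)" "seq_sup (\<lambda>n. y) y"
    by (auto simp: seq_sup_def mono_def)
  then show ?thesis
    using assms unfolding way_below_def by blast
qed

lemma way_below_interpolate:
  fixes x :: "'a::cu_semigroup"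
  assumes "x \<lless> y" obtains z where "x \<lless> z" "z \<lless> y"
proof -
  obtain X where X: "\<And>n. X n \<lless> X (Suc n)" "seq_sup X y"
    using O2 by blast
  then have "incseq X"
    by (intro incseq_SucI way_below_imp_le)
  then obtain n where "x \<le> X n"
    using assms X(2) unfolding way_below_def by blast
  then show thesis
    using that[of "X (Suc n)"] X le_trans_way_below way_below_trans_le
    unfolding seq_sup_def by blast
qed

lemma limitin_functional_topology:
  fixes l :: "'a::cu_semigroup \<Rightarrow> ennreal"
  assumes l: "l \<in> functionals" and f: "\<forall>\<^sub>F i in F. f i \<in> functionals"
  shows "limitin functional_topology f l F \<longleftrightarrow> functional_conv f l F"
proof
  assume lim: "limitin functional_topology f l F"
  show "functional_conv f l F"
    unfolding functional_conv_def
  proof (intro allI impI conjI)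
    fix x' x :: 'a assume xx: "x' \<lless> x"
    show "Limsup F (\<lambda>i. f i x') \<le> l x"
    proof (rule dense_ge)
      fix r assume r: "l x < r"
      define U where "U = {m \<in> functionals. \<exists>y. x' \<lless> y \<and> m y < r}"
      have "openin functional_topology U"
        unfolding openin_functional_topology
      proof (intro conjI ballI allI impI)
        show "U \<subseteq> functionals" by (auto simp: U_def)
        fix m G assume m: "m \<in> U" and G: "\<forall>\<^sub>F k in G. k \<in> functionals"
          and conv: "functional_conv (\<lambda>k. k) m G"
        obtain y where y: "x' \<lless> y" "m y < r" using m by (auto simp: U_def)
        obtain z where z: "x' \<lless> z" "z \<lless> y" using way_below_interpolate y(1) by blast
        have "Limsup G (\<lambda>k. k z) < r"
          using conv z y(2) unfolding functional_conv_def by (meson le_less_trans)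
        then have "\<forall>\<^sub>F k in G. k z < r" by (rule Limsup_lessD)
        then show "\<forall>\<^sub>F k in G. k \<in> U"
          using G by eventually_elim (use z in \<open>auto simp: U_def\<close>)
      qed
      moreover have "l \<in> U" using l xx r by (auto simp: U_def)
      ultimately have "\<forall>\<^sub>F i in F. f i \<in> U" using lim by (auto simp: limitin_def)
      then have "\<forall>\<^sub>F i in F. f i x' \<le> r"
      proof eventually_elim
        case (elim i)
        then obtain y where y: "x' \<lless> y" "f i y < r" "mono (f i)"
          by (auto simp: U_def functionals_def)
        then have "f i x' \<le> f i y" by (meson monoD way_below_imp_le)
        then show ?case using y by auto
      qed
      then show "Limsup F (\<lambda>i. f i x') \<le> r" by (rule Limsup_bounded)
    qed
    show "l x \<le> Liminf F (\<lambda>i. f i x)"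
    proof (rule dense_le)
      fix r assume r: "r < l x"
      define U where "U = {m \<in> functionals. r < m x}"
      have "openin functional_topology U"
        unfolding openin_functional_topology
      proof (intro conjI ballI allI impI)
        show "U \<subseteq> functionals" by (auto simp: U_def)
        fix m G assume m: "m \<in> U" and G: "\<forall>\<^sub>F k in G. k \<in> functionals"
          and conv: "functional_conv (\<lambda>k. k) m G"
        have "r < m x" using m by (simp add: U_def)
        moreover have "m x \<le> Liminf G (\<lambda>k. k x)"
          using conv xx unfolding functional_conv_def by blast
        ultimately have "r < Liminf G (\<lambda>k. k x)" by (rule less_le_trans)
        then have "\<forall>\<^sub>F k in G. r < k x" by (rule less_LiminfD)
        then show "\<forall>\<^sub>F k in G. k \<in> U"
          using G by eventually_elim (auto simp: U_def)
      qed
      moreover have "l \<in> U" using l r by (auto simp: U_def)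
      ultimately have "\<forall>\<^sub>F i in F. f i \<in> U" using lim by (auto simp: limitin_def)
      then have "\<forall>\<^sub>F i in F. r \<le> f i x" by eventually_elim (auto simp: U_def)
      then show "r \<le> Liminf F (\<lambda>i. f i x)" by (rule Liminf_bounded)
    qed
  qed
next
  assume conv: "functional_conv f l F"
  then have "functional_conv (\<lambda>m. m) l (filtermap f F)"
    by (simp add: functional_conv_def Limsup_le_iff le_Liminf_iff eventually_filtermap)
  moreover have "\<forall>\<^sub>F m in filtermap f F. m \<in> functionals"
    using f by (simp add: eventually_filtermap)
  ultimately have "\<forall>\<^sub>F m in filtermap f F. m \<in> U"
    if "openin functional_topology U" "l \<in> U" for U
    using that unfolding openin_functional_topology by simp
  then show "limitin functional_topology f l F"
    using l by (simp add: limitin_def eventually_filtermap)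
qed

end

(* The conditions only involve finitely many elements of S at a time, and a basic neighbourhood
   of mu is given by finitely many strict bounds nu(x_i') < s_i and r_j < nu(y_j), where
   x_i' << x_i, mu(x_i) < s_i and r_j < mu(y_j). If no nu in the cone satisfies them, a finite
   dimensional separation argument gives coefficients, which can be perturbed to natural numbers
   p_i > 0 and q_j, such that sum_j q_j y_j <= sum_i p_i x_i' holds on K but
   sum_j q_j y_j <= sum_i p_i x_i fails at mu, contradicting (ii). The passage between (ii) and
   (iii) replaces x and y by the multiples n x and (n + 1) y. *)

theory Submission
  imports Defs
begin

section \<open>The way-below relation and functionals on finite sums\<close>

lemma way_below_zero: "0 \<lless> (x::'a::cu_semigroup)"
  unfolding way_below_def using cu_zero_le by blast

lemma way_below_sum:
  fixes f g :: "'i \<Rightarrow> 'a::cu_semigroup"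
  assumes "\<And>i. i \<in> A \<Longrightarrow> f i \<lless> g i"
  shows "sum f A \<lless> sum g A"
  using assms by (induction A rule: infinite_finite_induct) (auto simp: way_below_zero O3)

lemma functional_mono: "l \<in> functionals \<Longrightarrow> x \<le> y \<Longrightarrow> l x \<le> l y"
  by (auto simp: functionals_def dest: monoD)

lemma functional_sum:
  assumes "l \<in> functionals"
  shows "l (sum f A) = (\<Sum>i\<in>A. l (f i))"
  using assms by (induction A rule: infinite_finite_induct) (auto simp: functionals_def)

text \<open>By (O2), \<open>x\<close> is the supremum of a sequence of elements way below it, and
  \<open>l\<close> preserves that supremum. This is what recovers (ii) from (iii), whose conclusion
  only reaches elements way below \<open>x\<close>.\<close>

lemma functional_eq_SUP_way_below:
  assumes l: "l \<in> functionals"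
  shows "l x = (SUP x'\<in>{x'. x' \<lless> x}. l x')"
proof (rule antisym)
  obtain X where X: "\<And>n. X n \<lless> X (Suc n)" "seq_sup X x"
    using O2 by blast
  then have "incseq X"
    by (intro incseq_SucI way_below_imp_le)
  then have "l x = (SUP n. l (X n))"
    using l X(2) by (auto simp: functionals_def)
  also have "\<dots> \<le> (SUP x'\<in>{x'. x' \<lless> x}. l x')"
  proof (rule SUP_mono)
    fix n
    have "X n \<lless> x"
      using X way_below_trans_le unfolding seq_sup_def by blast
    then show "\<exists>x'\<in>{x'. x' \<lless> x}. l (X n) \<le> l x'"
      by blast
  qed
  finally show "l x \<le> (SUP x'\<in>{x'. x' \<lless> x}. l x')" .
qed (use way_below_imp_le in \<open>auto intro!: SUP_least functional_mono[OF l]\<close>)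

section \<open>The cone generated by a set of functionals\<close>

lemma generated_coneE:
  assumes "m \<in> generated_cone A"
  obtains n :: nat and u l where "m = (\<lambda>x. \<Sum>j<n. ennreal (u j) * l j x)" "1 \<le> n"
    "\<forall>j<n. 0 < u j \<and> l j \<in> A"
  using assms unfolding generated_cone_def by (elim CollectE exE conjE) (rule that)

lemma generated_cone_scaled:
  assumes "l \<in> A" "0 < t"
  shows "(\<lambda>x. ennreal t * l x) \<in> generated_cone A"
  unfolding generated_cone_def mem_Collect_eq
  by (rule exI[of _ 1], rule exI[of _ "\<lambda>_. t"], rule exI[of _ "\<lambda>_. l"]) (use assms in simp)

lemma generated_cone_scale:
  assumes "m \<in> generated_cone A" "0 < t"
  shows "(\<lambda>x. ennreal t * m x) \<in> generated_cone A"
proof -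
  obtain n :: nat and u l where m: "m = (\<lambda>x. \<Sum>j<n. ennreal (u j) * l j x)" "1 \<le> n"
    and ul: "\<forall>j<n. 0 < u j \<and> l j \<in> A"
    using assms(1) by (rule generated_coneE)
  have "(\<lambda>x. ennreal t * m x) = (\<lambda>x. \<Sum>j<n. ennreal (t * u j) * l j x)"
    unfolding m sum_distrib_left using ul assms(2)
    by (intro ext sum.cong) (auto simp: ennreal_mult' mult.assoc)
  then show ?thesis
    unfolding generated_cone_def using m(2) ul assms(2)
    by (intro CollectI exI[of _ n] exI[of _ "\<lambda>j. t * u j"] exI[of _ l]) auto
qed

lemma generated_cone_add:
  assumes "m \<in> generated_cone A" "m' \<in> generated_cone A"
  shows "(\<lambda>x. m x + m' x) \<in> generated_cone A"
proof -
  obtain n :: nat and u l where m: "m = (\<lambda>x. \<Sum>j<n. ennreal (u j) * l j x)" "1 \<le> n"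
    and ul: "\<forall>j<n. 0 < u j \<and> l j \<in> A"
    using assms(1) by (rule generated_coneE)
  obtain n' :: nat and u' l' where m': "m' = (\<lambda>x. \<Sum>j<n'. ennreal (u' j) * l' j x)"
    and ul': "\<forall>j<n'. 0 < u' j \<and> l' j \<in> A"
    using assms(2) by (rule generated_coneE)
  define v where "v j = (if j < n then u j else u' (j - n))" for j
  define k where "k j = (if j < n then l j else l' (j - n))" for j
  have split: "(\<Sum>j<n + n'. f j) = (\<Sum>j<n. f j) + (\<Sum>j<n'. f (n + j))" for f :: "nat \<Rightarrow> ennreal"
    by (induction n') (simp_all add: add.assoc)
  have "(\<lambda>x. m x + m' x) = (\<lambda>x. \<Sum>j<n + n'. ennreal (v j) * k j x)"
    unfolding m m' split by (intro ext arg_cong2[where f = "(+)"] sum.cong) (auto simp: v_def k_def)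
  moreover have "\<forall>j<n + n'. 0 < v j \<and> k j \<in> A"
    using ul ul' by (auto simp: v_def k_def)
  ultimately show ?thesis
    unfolding generated_cone_def using m(2)
    by (intro CollectI exI[of _ "n + n'"] exI[of _ v] exI[of _ k]) auto
qed

text \<open>The sums defining the cone are nonempty, so the induction starts from a single scaled
  generator.\<close>

lemma generated_cone_induct [consumes 1, case_names scaled add]:
  assumes "m \<in> generated_cone A"
    and "\<And>t l. 0 < t \<Longrightarrow> l \<in> A \<Longrightarrow> P (\<lambda>x. ennreal t * l x)"
    and "\<And>m m'. P m \<Longrightarrow> P m' \<Longrightarrow> P (\<lambda>x. m x + m' x)"
  shows "P m"
proof -
  obtain n :: nat and u l where m: "m = (\<lambda>x. \<Sum>j<n. ennreal (u j) * l j x)" "1 \<le> n"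
    and ul: "\<forall>j<n. 0 < u j \<and> l j \<in> A"
    using assms(1) by (rule generated_coneE)
  have "P (\<lambda>x. \<Sum>j<n. ennreal (u j) * l j x)"
    using m(2) ul by (induction n rule: nat_induct_at_least) (auto intro!: assms(2,3))
  then show ?thesis
    by (simp add: m)
qed

lemma generated_cone_functionals:
  assumes "A \<subseteq> functionals"
  shows "generated_cone A \<subseteq> functionals"
proof
  fix m assume "m \<in> generated_cone A"
  then show "m \<in> functionals"
  proof (induction rule: generated_cone_induct)
    case (scaled t l)
    then have "l \<in> functionals"
      using assms by auto
    then show ?case
      by (auto simp: functionals_def mono_def SUP_mult_left_ennreal distrib_left
          intro!: mult_left_mono)
  next
    case (add m m')
    \<comment> \<open>Addition commutes with these suprema because both sequences are
      increasing.\<close>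
    then have "(SUP n. m (X n)) + (SUP n. m' (X n)) = (SUP n. m (X n) + m' (X n))"
      if "incseq X" for X
      using that by (intro ennreal_SUP_add[symmetric]) (auto simp: functionals_def mono_def)
    then show ?case
      using add by (auto simp: functionals_def mono_def add_mono ac_simps)
  qed
qed

lemma generated_cone_le:
  assumes "m \<in> generated_cone A" "\<And>l. l \<in> A \<Longrightarrow> l x \<le> l y"
  shows "m x \<le> m y"
  using assms(1) by (induction rule: generated_cone_induct) (auto intro: mult_left_mono add_mono assms(2))

section \<open>Separation in finite dimension\<close>

text \<open>Gordan's alternative for a convex set of vectors, by induction on the number of
  coordinates. In the step the problem is reduced to the plane: the last coordinate against the
  combination that the induction hypothesis provides on the part where the last coordinate is
  negative.\<close>

lemma gordan_alternative:
  fixes W :: "('i \<Rightarrow> real) set"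
  assumes "finite I" "W \<noteq> {}"
    and "\<And>v w t. v \<in> W \<Longrightarrow> w \<in> W \<Longrightarrow> 0 < t \<Longrightarrow> t < 1 \<Longrightarrow> (\<lambda>i. t * v i + (1 - t) * w i) \<in> W"
    and "\<not> (\<exists>w\<in>W. \<forall>i\<in>I. w i < 0)"
  shows "\<exists>a. (\<forall>i\<in>I. 0 \<le> a i) \<and> (\<exists>i\<in>I. 0 < a i) \<and> (\<forall>w\<in>W. 0 \<le> (\<Sum>i\<in>I. a i * w i))"
  using assms
proof (induction I arbitrary: W rule: finite_induct)
  case empty
  then show ?case by auto
next
  case (insert k I W)
  note convex = insert.prems(2)
  define W' where "W' = {w\<in>W. w k < 0}"
  show ?case
  proof (cases "W' = {}")
    case True
    \<comment> \<open>No vector is negative at \<open>k\<close>, so the unit vector at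
      \<open>k\<close> serves as the coefficient vector.\<close>
    then have "\<forall>w\<in>W. 0 \<le> (\<Sum>i\<in>insert k I. (if i = k then 1 else 0) * w i)"
      using insert.hyps by (force simp: W'_def if_distrib if_distribR cong: if_cong)
    then show ?thesis
      by (intro exI[of _ "\<lambda>i. if i = k then 1 else 0"]) auto
  next
    case False
    have "(\<lambda>i. t * v i + (1 - t) * w i) \<in> W'" if "v \<in> W'" "w \<in> W'" "0 < t" "t < 1" for v w t
      using that convex by (auto simp: W'_def intro!: add_neg_neg mult_pos_neg)
    moreover have "\<not> (\<exists>w\<in>W'. \<forall>i\<in>I. w i < 0)"
      using insert.prems(3) by (auto simp: W'_def)
    ultimately obtain a where a: "\<forall>i\<in>I. 0 \<le> a i" "\<exists>i\<in>I. 0 < a i"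
      and aW': "\<forall>w\<in>W'. 0 \<le> (\<Sum>i\<in>I. a i * w i)"
      using insert.IH[OF False] by blast
    define g where "g w = (\<Sum>i\<in>I. a i * w i)" for w
    have g_comb: "g (\<lambda>i. t * v i + (1 - t) * w i) = t * g v + (1 - t) * g w" for t v w
      by (simp add: g_def sum_distrib_left sum.distrib distrib_left mult.left_commute)
    have g_neg: "0 \<le> g w" if "w \<in> W" "w k < 0" for w
      using that aW' by (auto simp: W'_def g_def)
    obtain w0 where w0: "w0 \<in> W" "w0 k < 0"
      using False by (auto simp: W'_def)
    \<comment> \<open>If \<open>g w\<close> were negative on the hyperplane, a point on the segment
      from \<open>w\<close> to \<open>w0\<close> would be negative at \<open>k\<close> and still
      have negative \<open>g\<close>, against \<open>g_neg\<close>.\<close>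
    have g_zero: "0 \<le> g w" if w: "w \<in> W" "w k = 0" for w
    proof (rule ccontr)
      assume "\<not> 0 \<le> g w"
      then have neg: "g w < 0" by simp
      \<comment> \<open>This weight makes the value of \<open>g\<close> at the mixture exactly half
        of \<open>g w\<close>.\<close>
      define t where "t = - g w / (2 * (g w0 - g w))"
      have "g w0 \<ge> 0" using g_neg w0 by blast
      then have t: "0 < t" "t < 1" "t * (g w0 - g w) = - g w / 2"
        using neg by (auto simp: t_def field_simps)
      let ?v = "\<lambda>i. t * w0 i + (1 - t) * w i"
      have "0 \<le> g ?v"
        using t w w0 by (intro g_neg convex) (auto simp: mult_pos_neg)
      also have "g ?v = g w / 2"
        unfolding g_comb using t(3) by (simp add: algebra_simps)
      finally show False using neg by simp
    qed
    have cross: "0 \<le> g w * - v k + g v * w k" if "v \<in> W" "v k < 0" "w \<in> W" "0 < w k" for v w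
    proof -
      \<comment> \<open>At this weight the segment between \<open>v\<close> and \<open>w\<close>
        crosses the hyperplane where coordinate \<open>k\<close> vanishes, and \<open>g_zero\<close>
        applies.\<close>
      define t where "t = w k / (w k - v k)"
      have t: "0 < t" "t < 1" "1 - t = - v k / (w k - v k)"
        using that by (auto simp: t_def field_simps)
      let ?u = "\<lambda>i. t * v i + (1 - t) * w i"
      have "?u k = 0"
        unfolding t(3) using that by (simp add: t_def field_simps)
      then have "0 \<le> g ?u"
        using t that by (intro g_zero convex) auto
      also have "g ?u = (g w * - v k + g v * w k) / (w k - v k)"
        unfolding g_comb unfolding t(3) by (simp add: t_def add_divide_distrib diff_divide_distrib mult.commute)
      finally show ?thesis
        using that by (simp add: zero_le_divide_iff)
    qed
    \<comment> \<open>By \<open>cross\<close>, every quotient \<open>g v / - v k\<close> on the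
      negative side is at least every \<open>- g w / w k\<close> on the positive side. The infimum
      \<open>c\<close> separates the two families and becomes the coefficient at
      \<open>k\<close>.\<close>
    define c where "c = (INF v\<in>W'. g v / - v k)"
    have bdd: "bdd_below ((\<lambda>v. g v / - v k) ` W')"
      using g_neg by (intro bdd_belowI2[of _ 0] divide_nonneg_pos) (auto simp: W'_def)
    have c0: "0 \<le> c"
      unfolding c_def using False g_neg
      by (intro cINF_greatest divide_nonneg_pos) (auto simp: W'_def)
    have main: "0 \<le> c * w k + g w" if w: "w \<in> W" for w
    proof (cases "w k" "0::real" rule: linorder_cases)
      case less
      then have "c \<le> g w / - w k"
        unfolding c_def using w bdd by (intro cINF_lower) (auto simp: W'_def)
      then show ?thesis
        using less by (simp add: field_simps)
    next
      case equal
      then show ?thesis using g_zero w by simp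
    next
      case greater
      have "- g w / w k \<le> c"
        unfolding c_def
      proof (rule cINF_greatest[OF False])
        fix v assume "v \<in> W'"
        then show "- g w / w k \<le> g v / - v k"
          using cross[of v w] w greater by (auto simp: W'_def field_simps)
      qed
      then show ?thesis
        using greater by (simp add: field_simps)
    qed
    have "(\<Sum>i\<in>insert k I. (a(k := c)) i * w i) = c * w k + g w" for w
    proof -
      have "(\<Sum>i\<in>I. (a(k := c)) i * w i) = g w"
        unfolding g_def using insert.hyps by (intro sum.cong) auto
      then show ?thesis
        using insert.hyps by simp
    qed
    \<comment> \<open>Since \<open>k\<close> is not in \<open>I\<close>, the positive coefficient
      from the induction hypothesis survives the update, even when \<open>c\<close> is 0.\<close>
    then show ?thesis
      using a c0 main insert.hyps by (intro exI[of _ "a(k := c)"]) auto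
  qed
qed

section \<open>Approximation by cone elements on finitely many elements\<close>

text \<open>The Archimedean property. It removes errors that do not grow with the multiple: those
  from rounding coefficients, and those from the factor \<open>n / (n + 1)\<close>.\<close>

lemma nonpos_if_multiples_bounded:
  fixes x c :: real
  assumes "\<And>n. real n * x \<le> c"
  shows "x \<le> 0"
proof (rule ccontr)
  assume "\<not> x \<le> 0"
  then obtain n where "c < real n * x"
    using reals_Archimedean3[of x] by auto
  then show False
    using assms[of n] by simp
qed

text \<open>\<open>ennreal\<close> truncates negative reals to 0, so for mixed signs only an
  inequality remains. It serves for lower bounds \<open>r j - w (Inr j)\<close> that may be
  negative.\<close>

lemma ennreal_plus_le: "ennreal (a + b) \<le> ennreal a + ennreal b"
proof (cases "0 \<le> a \<and> 0 \<le> b")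
  case False
  then have "a + b \<le> b \<or> a + b \<le> a" by auto
  then show ?thesis
  proof
    assume "a + b \<le> b"
    then show ?thesis
      using add_increasing[OF zero_le ennreal_leI] by blast
  next
    assume "a + b \<le> a"
    then show ?thesis
      using add_increasing2[OF zero_le ennreal_leI] by blast
  qed
qed simp

text \<open>If the approximation fails, Gordan's alternative yields an inequality between real
  combinations of the \<^term>\<open>y j\<close> and the \<^term>\<open>x' i\<close>, valid on those functionals of
  \<^term>\<open>K\<close> that are finite at every \<^term>\<open>x' i\<close>. Rounding the coefficients of the
  \<^term>\<open>x' i\<close> up to positive integers makes the remaining functionals harmless, since the
  right-hand side is then infinite.\<close>

lemma generated_cone_approximation:
  fixes K :: "('a::cu_semigroup \<Rightarrow> ennreal) set" and \<mu> :: "'a \<Rightarrow> ennreal"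
    and x' x :: "'i \<Rightarrow> 'a" and y :: "'j \<Rightarrow> 'a" and s :: "'i \<Rightarrow> real" and r :: "'j \<Rightarrow> real"
  assumes K: "K \<subseteq> functionals" and \<mu>: "\<mu> \<in> functionals"
    and dom: "\<And>x y' y. \<forall>l\<in>K. l x \<le> l y' \<Longrightarrow> y' \<lless> y \<Longrightarrow> \<mu> x \<le> \<mu> y"
    and fin: "finite A" "finite B"
    and A: "\<And>i. i \<in> A \<Longrightarrow> x' i \<lless> x i \<and> \<mu> (x i) < ennreal (s i)"
    and B: "\<And>j. j \<in> B \<Longrightarrow> 0 \<le> r j \<and> ennreal (r j) < \<mu> (y j)"
  shows "\<exists>\<nu>\<in>generated_cone (K \<union> {\<lambda>_. 0}).
    (\<forall>i\<in>A. \<nu> (x' i) < ennreal (s i)) \<and> (\<forall>j\<in>B. ennreal (r j) < \<nu> (y j))"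
proof (rule ccontr)
  let ?C = "generated_cone (K \<union> {\<lambda>_. 0})"
  assume none: "\<not> ?thesis"
  \<comment> \<open>\<open>w\<close> records by how much the bounds must be relaxed for \<nu> to
    satisfy them; an all-negative \<open>w\<close> would give the strict bounds sought. The explicit
    sign condition prevents the truncation in \<open>ennreal\<close> from accepting negative upper
    bounds. Using inequalities lets \<nu> be infinite at \<open>y j\<close>.\<close>
  define ok where "ok \<nu> w \<longleftrightarrow>
      (\<forall>i\<in>A. 0 \<le> s i + w (Inl i) \<and> \<nu> (x' i) \<le> ennreal (s i + w (Inl i))) \<and>
      (\<forall>j\<in>B. ennreal (r j - w (Inr j)) \<le> \<nu> (y j))" for \<nu> :: "'a \<Rightarrow> ennreal" and w
  define W where "W = {w. \<exists>\<nu>\<in>?C. ok \<nu> w}"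
  have s_pos: "0 < s i" if "i \<in> A" for i
    using A[OF that] by (auto simp flip: ennreal_less_zero_iff intro: le_less_trans[OF zero_le])
  have zero: "(\<lambda>_. 0) \<in> ?C"
    using generated_cone_scaled[of "\<lambda>_. 0" "K \<union> {\<lambda>_. 0}" 1] by simp
  \<comment> \<open>The zero functional needs no relaxation at the \<open>x' i\<close> and
    relaxation \<open>r j\<close> at \<open>y j\<close>.\<close>
  have "(\<lambda>i. case i of Inl i \<Rightarrow> 0 | Inr j \<Rightarrow> r j) \<in> W"
    unfolding W_def using zero s_pos by (auto simp: ok_def intro!: bexI[of _ "\<lambda>_. 0"] less_imp_le)
  then have "W \<noteq> {}" by blast
  moreover have "(\<lambda>i. t * v i + (1 - t) * w i) \<in> W"
    if v: "v \<in> W" and w: "w \<in> W" and t: "0 < t" "t < 1" for v w t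
  proof -
    obtain \<nu> where \<nu>: "\<nu> \<in> ?C" "ok \<nu> v"
      using v by (auto simp: W_def)
    obtain \<rho> where \<rho>: "\<rho> \<in> ?C" "ok \<rho> w"
      using w by (auto simp: W_def)
    let ?\<tau> = "\<lambda>z. ennreal t * \<nu> z + ennreal (1 - t) * \<rho> z"
    let ?u = "\<lambda>i. t * v i + (1 - t) * w i"
    have "?\<tau> \<in> ?C"
      using \<nu> \<rho> t by (intro generated_cone_add generated_cone_scale) auto
    moreover have "ok ?\<tau> ?u"
      unfolding ok_def
    proof (intro conjI ballI)
      fix i assume i: "i \<in> A"
      have eq: "s i + ?u (Inl i) = t * (s i + v (Inl i)) + (1 - t) * (s i + w (Inl i))"
        by (simp add: algebra_simps)
      have nn: "0 \<le> s i + v (Inl i)" "0 \<le> s i + w (Inl i)"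
        using \<nu>(2) \<rho>(2) i by (auto simp: ok_def)
      then show "0 \<le> s i + ?u (Inl i)"
        unfolding eq using t by auto
      have "?\<tau> (x' i) \<le> ennreal t * ennreal (s i + v (Inl i)) + ennreal (1 - t) * ennreal (s i + w (Inl i))"
        using \<nu>(2) \<rho>(2) i by (intro add_mono mult_left_mono) (auto simp: ok_def)
      also have "\<dots> = ennreal (s i + ?u (Inl i))"
        unfolding eq using t nn by (simp add: ennreal_mult)
      finally show "?\<tau> (x' i) \<le> ennreal (s i + ?u (Inl i))" .
    next
      fix j assume j: "j \<in> B"
      have eq: "r j - ?u (Inr j) = t * (r j - v (Inr j)) + (1 - t) * (r j - w (Inr j))"
        by (simp add: algebra_simps)
      have "ennreal (r j - ?u (Inr j)) \<le> ennreal (t * (r j - v (Inr j))) + ennreal ((1 - t) * (r j - w (Inr j)))"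
        unfolding eq by (rule ennreal_plus_le)
      also have "\<dots> = ennreal t * ennreal (r j - v (Inr j)) + ennreal (1 - t) * ennreal (r j - w (Inr j))"
        using t by (simp add: ennreal_mult')
      also have "\<dots> \<le> ?\<tau> (y j)"
        using \<nu>(2) \<rho>(2) j by (intro add_mono mult_left_mono) (auto simp: ok_def)
      finally show "ennreal (r j - ?u (Inr j)) \<le> ?\<tau> (y j)" .
    qed
    ultimately show ?thesis
      unfolding W_def by blast
  qed
  moreover have "\<not> (\<exists>w\<in>W. \<forall>i\<in>A <+> B. w i < 0)"
  proof
    assume "\<exists>w\<in>W. \<forall>i\<in>A <+> B. w i < 0"
    then obtain w \<nu> where w: "\<forall>i\<in>A <+> B. w i < 0" and \<nu>: "\<nu> \<in> ?C" "ok \<nu> w"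
      by (auto simp: W_def)
    have "\<nu> (x' i) < ennreal (s i)" if i: "i \<in> A" for i
    proof -
      have "\<nu> (x' i) \<le> ennreal (s i + w (Inl i))"
        using \<nu> i by (auto simp: ok_def)
      also have "\<dots> < ennreal (s i)"
        using w s_pos[OF i] i by (intro ennreal_lessI) auto
      finally show ?thesis .
    qed
    moreover have "ennreal (r j) < \<nu> (y j)" if j: "j \<in> B" for j
    proof -
      have "w (Inr j) < 0" "0 \<le> r j"
        using w B j by auto
      then have "ennreal (r j) < ennreal (r j - w (Inr j))"
        by (intro ennreal_lessI) auto
      also have "\<dots> \<le> \<nu> (y j)"
        using \<nu> j by (auto simp: ok_def)
      finally show ?thesis .
    qed
    ultimately show False
      using none \<nu>(1) by blast
  qed
  ultimately obtain c where c: "\<forall>i\<in>A <+> B. 0 \<le> c i" "\<exists>i\<in>A <+> B. 0 < c i"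
    and cW: "\<And>w. w \<in> W \<Longrightarrow> 0 \<le> (\<Sum>i\<in>A <+> B. c i * w i)"
    using gordan_alternative[of "A <+> B" W] finite_Plus[OF fin] by blast
  define a where "a = c \<circ> Inl"
  define b where "b = c \<circ> Inr"
  have a0: "0 \<le> a i" if "i \<in> A" for i
    using c(1) that by (auto simp: a_def)
  have b0: "0 \<le> b j" if "j \<in> B" for j
    using c(1) that by (auto simp: b_def)
  \<comment> \<open>Gordan's inequality rewritten for the bounds \<open>u\<close> and
    \<open>v\<close> themselves instead of the relaxations.\<close>
  have key: "0 \<le> (\<Sum>i\<in>A. a i * (u i - s i)) + (\<Sum>j\<in>B. b j * (r j - v j))"
    if "\<nu> \<in> ?C" "\<forall>i\<in>A. 0 \<le> u i \<and> \<nu> (x' i) \<le> ennreal (u i)" "\<forall>j\<in>B. ennreal (v j) \<le> \<nu> (y j)"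
    for \<nu> u v
  proof -
    have "(\<lambda>k. case k of Inl i \<Rightarrow> u i - s i | Inr j \<Rightarrow> r j - v j) \<in> W"
      unfolding W_def using that by (auto simp: ok_def)
    from cW[OF this] show ?thesis
      using fin by (simp add: sum.Plus a_def b_def)
  qed
  have base: "(\<Sum>i\<in>A. a i * s i) \<le> (\<Sum>j\<in>B. b j * r j)"
    using key[OF zero, of "\<lambda>_. 0" "\<lambda>_. 0"] by (simp add: sum_negf)
  \<comment> \<open>The cone contains all positive multiples of \<open>l\<close>, so the constant
    terms with \<open>s\<close> and \<open>r\<close> can be made negligible by scaling.\<close>
  have homog: "(\<Sum>j\<in>B. b j * v j) \<le> (\<Sum>i\<in>A. a i * u i)"
    if l: "l \<in> K" and u: "\<forall>i\<in>A. 0 \<le> u i \<and> l (x' i) \<le> ennreal (u i)"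
      and v: "\<forall>j\<in>B. ennreal (v j) \<le> l (y j)" for l u v
  proof (rule ccontr)
    assume neg: "\<not> ?thesis"
    define D where "D = (\<Sum>j\<in>B. b j * v j) - (\<Sum>i\<in>A. a i * u i)"
    define E where "E = (\<Sum>j\<in>B. b j * r j) - (\<Sum>i\<in>A. a i * s i)"
    \<comment> \<open>Chosen so that scaling by \<open>t\<close> turns the right-hand side of
      \<open>key\<close> into \<open>E - t * D\<close>, which is -1.\<close>
    define t where "t = (E + 1) / D"
    have D: "0 < D" and E: "0 \<le> E"
      using neg base by (auto simp: D_def E_def)
    then have t: "0 < t" "t * D = E + 1"
      by (auto simp: t_def)
    have "(\<lambda>z. ennreal t * l z) \<in> ?C"
      using l t by (intro generated_cone_scaled) auto
    then have "0 \<le> (\<Sum>i\<in>A. a i * (t * u i - s i)) + (\<Sum>j\<in>B. b j * (r j - t * v j))"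
      using u v t by (intro key[where \<nu> = "\<lambda>z. ennreal t * l z"])
        (auto simp: ennreal_mult' intro!: mult_left_mono)
    also have "\<dots> = E - t * D"
      by (simp add: D_def E_def right_diff_distrib sum_subtractf sum_distrib_left mult.left_commute)
    finally show False
      using t by simp
  qed
  have multiple: "l (\<Sum>i\<in>I. \<Sum>_<p i. z i) = (\<Sum>i\<in>I. ennreal (p i) * l (z i))"
    if "l \<in> functionals" for l :: "'a \<Rightarrow> ennreal" and p :: "'k \<Rightarrow> nat" and z :: "'k \<Rightarrow> 'a" and I
    using that by (simp add: functional_sum ennreal_of_nat_eq_real_of_nat)
  have K_le: "l (\<Sum>j\<in>B. \<Sum>_<q j. y j) \<le> l (\<Sum>i\<in>A. \<Sum>_<p i. x' i)"
    if l: "l \<in> K" and p: "\<And>i. i \<in> A \<Longrightarrow> N * a i \<le> real (p i) \<and> 1 \<le> p i"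
      and q: "\<And>j. j \<in> B \<Longrightarrow> real (q j) \<le> N * b j" and N: "0 \<le> N" for l p q N
  proof -
    have lf: "l \<in> functionals" using l K by blast
    show ?thesis
    proof (cases "\<exists>i\<in>A. l (x' i) = \<infinity>")
      case True
      then obtain i where i: "i \<in> A" "l (x' i) = \<infinity>" by blast
      then have "ennreal (p i) * l (x' i) = \<infinity>"
        using p[OF i(1)] by (simp add: ennreal_mult_eq_top_iff)
      moreover have "ennreal (p i) * l (x' i) \<le> l (\<Sum>i\<in>A. \<Sum>_<p i. x' i)"
        unfolding multiple[OF lf] using i(1) fin by (intro member_le_sum) auto
      ultimately have "l (\<Sum>i\<in>A. \<Sum>_<p i. x' i) = \<infinity>"
        by (simp add: top_unique)
      then show ?thesis by simp
    next
      case False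
      define u where "u i = enn2real (l (x' i))" for i
      have u: "l (x' i) = ennreal (u i)" "0 \<le> u i" if "i \<in> A" for i
        using False that by (auto simp: u_def less_top)
      \<comment> \<open>\<open>enn2real\<close> sends \<infinity> to 0, which is still a lower
        bound; \<open>qv\<close> shows that the product with \<open>q j\<close> is nevertheless
        exact.\<close>
      define v where "v j = enn2real (l (y j))" for j
      have v0: "0 \<le> v j" for j
        by (simp add: v_def)
      have v: "ennreal (v j) \<le> l (y j)" for j
        by (cases "l (y j)") (auto simp: v_def)
      have qv: "ennreal (q j) * l (y j) = ennreal (q j * v j)" if j: "j \<in> B" for j
      proof (cases "l (y j) = \<infinity>")
        case True
        \<comment> \<open>With all \<open>l (x' i)\<close> finite and \<open>l (y j)\<close>
          infinite, \<open>homog\<close> admits arbitrarily large bounds at \<open>j\<close>. The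
          choice of \<open>M\<close> makes the left-hand side exceed the right-hand side by 1 unless
          \<open>b j\<close> vanishes; then \<open>q j\<close> is 0 as well.\<close>
        have "b j = 0"
        proof (rule ccontr)
          assume "b j \<noteq> 0"
          then have bj: "0 < b j" using b0 j by force
          define M where "M = ((\<Sum>i\<in>A. a i * u i) + 1) / b j"
          have "(\<Sum>k\<in>B. b k * (if k = j then M else 0)) \<le> (\<Sum>i\<in>A. a i * u i)"
            using u True by (intro homog[OF l]) auto
          then have "b j * M \<le> (\<Sum>i\<in>A. a i * u i)"
            using fin j by (simp add: if_distrib cong: if_cong)
          then show False
            using bj by (simp add: M_def)
        qed
        then show ?thesis using q[OF j] by simp
      next
        case False
        then show ?thesis by (simp add: v_def ennreal_mult less_top)
      qed
      have "l (\<Sum>j\<in>B. \<Sum>_<q j. y j) = ennreal (\<Sum>j\<in>B. q j * v j)"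
        unfolding multiple[OF lf] using qv v0 by simp
      also have "(\<Sum>j\<in>B. q j * v j) \<le> (\<Sum>j\<in>B. N * b j * v j)"
        using q v0 by (intro sum_mono mult_right_mono) auto
      also have "\<dots> = N * (\<Sum>j\<in>B. b j * v j)"
        by (simp add: sum_distrib_left mult.assoc)
      also have "\<dots> \<le> N * (\<Sum>i\<in>A. a i * u i)"
        using u v N by (intro mult_left_mono homog[OF l]) auto
      also have "\<dots> = (\<Sum>i\<in>A. N * a i * u i)"
        by (simp add: sum_distrib_left mult.assoc)
      also have "\<dots> \<le> (\<Sum>i\<in>A. p i * u i)"
        using p u by (intro sum_mono mult_right_mono) auto
      also have "ennreal \<dots> = l (\<Sum>i\<in>A. \<Sum>_<p i. x' i)"
        unfolding multiple[OF lf] using u by (subst sum_ennreal[symmetric]) (auto simp: ennreal_mult)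
      finally show ?thesis
        by (simp add: ennreal_leI)
    qed
  qed
  define m where "m i = enn2real (\<mu> (x i))" for i
  have m: "\<mu> (x i) = ennreal (m i)" "0 \<le> m i" "m i < s i" if i: "i \<in> A" for i
  proof -
    have "\<mu> (x i) < \<infinity>"
      using A[OF i] by (auto intro: less_le_trans)
    then show eq: "\<mu> (x i) = ennreal (m i)" and "0 \<le> m i"
      by (simp_all add: m_def)
    then show "m i < s i"
      using A[OF i] by (simp add: ennreal_less_iff)
  qed
  \<comment> \<open>\<mu> may be infinite at \<open>y j\<close>, so a real bound strictly above
    \<open>r j\<close> stands in for its value.\<close>
  have "\<exists>r'. r j < r' \<and> ennreal r' \<le> \<mu> (y j)" if j: "j \<in> B" for j
  proof -
    obtain z where z: "ennreal (r j) < z" "z < \<mu> (y j)"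
      using B[OF j] dense by blast
    then obtain r' where "z = ennreal r'" by (cases z) auto
    then show ?thesis
      using z B[OF j] by (auto simp: ennreal_less_iff intro!: exI[of _ r'])
  qed
  then obtain r' where r': "\<And>j. j \<in> B \<Longrightarrow> r j < r' j \<and> ennreal (r' j) \<le> \<mu> (y j)"
    by metis
  have r'0: "0 \<le> r' j" if "j \<in> B" for j
    using B[OF that] r'[OF that] by auto
  \<comment> \<open>Scaling by \<open>N\<close> before rounding keeps the error independent of
    \<open>N\<close>: rounding down loses at most 1 in each \<open>q j\<close>. Rounding up and
    adding 1, which keeps \<open>p i\<close> positive when \<open>a i\<close> is 0, gains at most
    2.\<close>
  have bound: "real N * ((\<Sum>j\<in>B. b j * r' j) - (\<Sum>i\<in>A. a i * m i)) \<le> (\<Sum>j\<in>B. r' j) + 2 * (\<Sum>i\<in>A. m i)" for N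
  proof -
    define p where "p i = nat \<lceil>N * a i\<rceil> + 1" for i
    define q where "q j = nat \<lfloor>N * b j\<rfloor>" for j
    have p: "N * a i \<le> p i" "1 \<le> p i" "p i \<le> N * a i + 2" if "i \<in> A" for i
      using a0[OF that] by (simp_all add: p_def) linarith+
    have q: "q j \<le> N * b j" "N * b j - 1 \<le> q j" if "j \<in> B" for j
      using b0[OF that] by (simp_all add: q_def)
    have "ennreal (\<Sum>j\<in>B. q j * r' j) = (\<Sum>j\<in>B. ennreal (q j) * ennreal (r' j))"
      using r'0 by (subst sum_ennreal[symmetric]) (auto simp: ennreal_mult)
    also have "\<dots> \<le> (\<Sum>j\<in>B. ennreal (q j) * \<mu> (y j))"
      using r' by (intro sum_mono mult_left_mono) auto
    also have "\<dots> = \<mu> (\<Sum>j\<in>B. \<Sum>_<q j. y j)"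
      by (simp add: multiple[OF \<mu>])
    \<comment> \<open>Hypothesis \<open>dom\<close> carries the inequality from \<open>K\<close> to
      \<mu>, at the price of replacing \<open>x' i\<close> by \<open>x i\<close>.\<close>
    also have "\<dots> \<le> \<mu> (\<Sum>i\<in>A. \<Sum>_<p i. x i)"
    proof (rule dom)
      show "\<forall>l\<in>K. l (\<Sum>j\<in>B. \<Sum>_<q j. y j) \<le> l (\<Sum>i\<in>A. \<Sum>_<p i. x' i)"
      proof
        fix l assume "l \<in> K"
        then show "l (\<Sum>j\<in>B. \<Sum>_<q j. y j) \<le> l (\<Sum>i\<in>A. \<Sum>_<p i. x' i)"
        proof (rule K_le)
          show "real N * a i \<le> real (p i) \<and> 1 \<le> p i" if "i \<in> A" for i
            using p that by simp
        qed (use q in simp_all)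
      qed
      show "(\<Sum>i\<in>A. \<Sum>_<p i. x' i) \<lless> (\<Sum>i\<in>A. \<Sum>_<p i. x i)"
        using A by (intro way_below_sum) auto
    qed
    also have "\<dots> = ennreal (\<Sum>i\<in>A. p i * m i)"
      unfolding multiple[OF \<mu>] using m by (subst sum_ennreal[symmetric]) (auto simp: ennreal_mult)
    finally have "(\<Sum>j\<in>B. q j * r' j) \<le> (\<Sum>i\<in>A. p i * m i)"
      using m by (subst (asm) ennreal_le_iff) (auto intro!: sum_nonneg)
    moreover have "(\<Sum>j\<in>B. (N * b j - 1) * r' j) \<le> (\<Sum>j\<in>B. q j * r' j)"
      using q r'0 by (intro sum_mono mult_right_mono) auto
    moreover have "(\<Sum>i\<in>A. p i * m i) \<le> (\<Sum>i\<in>A. (N * a i + 2) * m i)"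
      using p m by (intro sum_mono mult_right_mono) auto
    ultimately have "(\<Sum>j\<in>B. (N * b j - 1) * r' j) \<le> (\<Sum>i\<in>A. (N * a i + 2) * m i)"
      by linarith
    then show ?thesis
      by (simp add: left_diff_distrib right_diff_distrib distrib_right sum.distrib sum_subtractf
          sum_distrib_left mult.assoc)
  qed
  from nonpos_if_multiples_bounded[OF bound]
  have "(\<Sum>j\<in>B. b j * r' j) \<le> (\<Sum>i\<in>A. a i * m i)" by simp
  moreover have am: "(\<Sum>i\<in>A. a i * m i) \<le> (\<Sum>i\<in>A. a i * s i)"
    using a0 m by (intro sum_mono mult_left_mono) (auto intro: less_imp_le)
  moreover have br: "(\<Sum>j\<in>B. b j * r j) \<le> (\<Sum>j\<in>B. b j * r' j)"
    using b0 r' by (intro sum_mono mult_left_mono) (auto intro: less_imp_le)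
  \<comment> \<open>Gordan's alternative provides a positive coefficient. The bound at its index has
    strict slack at \<mu>, so the chain of inequalities contradicts \<open>base\<close>.\<close>
  moreover have "(\<Sum>i\<in>A. a i * m i) < (\<Sum>i\<in>A. a i * s i) \<or> (\<Sum>j\<in>B. b j * r j) < (\<Sum>j\<in>B. b j * r' j)"
  proof -
    consider i where "i \<in> A" "0 < a i" | j where "j \<in> B" "0 < b j"
      using c(2) by (auto simp: a_def b_def)
    then show ?thesis
    proof cases
      case 1
      then have "(\<Sum>i\<in>A. a i * m i) < (\<Sum>i\<in>A. a i * s i)"
        using a0 m fin by (intro sum_strict_mono_ex1 ballI mult_left_mono bexI[of _ i])
          (auto simp: less_imp_le)
      then show ?thesis ..
    next
      case 2
      then have "(\<Sum>j\<in>B. b j * r j) < (\<Sum>j\<in>B. b j * r' j)"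
        using b0 r' fin by (intro sum_strict_mono_ex1 ballI mult_left_mono bexI[of _ j])
          (auto simp: less_imp_le)
      then show ?thesis ..
    qed
  qed
  ultimately show False
    using base by linarith
qed

section \<open>Closures in the topology of functionals\<close>

text \<open>The trace on \<open>C\<close> of the neighbourhood filter of \<mu> is proper and
  converges to \<mu>. Along it the lower limit at \<open>x\<close> bounds \<mu> from above there,
  and \<open>y' \<lless> y\<close> bounds the upper limit at \<open>y'\<close> by the value at
  \<open>y\<close>.\<close>

lemma closure_of_le:
  fixes C :: "('a::cu_semigroup \<Rightarrow> ennreal) set"
  assumes \<mu>: "\<mu> \<in> functional_topology closure_of C"
    and le: "\<And>m. m \<in> C \<Longrightarrow> m x \<le> m y'" and y: "y' \<lless> y"
  shows "\<mu> x \<le> \<mu> y"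
proof -
  have \<mu>f: "\<mu> \<in> functionals"
    using \<mu> by (simp add: in_closure_of)
  define F where "F = inf (nhdsin functional_topology \<mu>) (principal C)"
  have nhd: "eventually P (nhdsin functional_topology \<mu>) \<longleftrightarrow>
      (\<exists>U. openin functional_topology U \<and> \<mu> \<in> U \<and> (\<forall>m\<in>U. P m))" for P
    using \<mu>f by (simp add: eventually_nhdsin)
  have "\<not> eventually (\<lambda>_. False) F"
    using \<mu> unfolding F_def eventually_inf_principal nhd in_closure_of by blast
  then have "F \<noteq> bot" by auto
  have lim: "limitin functional_topology (\<lambda>m. m) \<mu> F"
    using \<mu>f by (auto simp: limitin_def F_def eventually_inf_principal nhd)
  moreover have "\<forall>\<^sub>F m in F. m \<in> functionals"
    using lim openin_topspace[of functional_topology]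
    by (auto simp: limitin_def)
  ultimately have conv: "functional_conv (\<lambda>m. m) \<mu> F"
    using limitin_functional_topology[OF \<mu>f, of "\<lambda>m. m" F] by blast
  \<comment> \<open>The lower half of convergence is stated for pairs \<open>x' \<lless> x\<close>;
    the pair of 0 and \<open>x\<close> supplies it for every \<open>x\<close>.\<close>
  have "\<mu> x \<le> Liminf F (\<lambda>m. m x)"
    using conv way_below_zero[of x] unfolding functional_conv_def by blast
  also have "\<dots> \<le> Limsup F (\<lambda>m. m x)"
    using \<open>F \<noteq> bot\<close> by (rule Liminf_le_Limsup)
  also have "\<dots> \<le> Limsup F (\<lambda>m. m y')"
    using le by (intro Limsup_mono) (auto simp: F_def eventually_inf_principal)
  also have "\<dots> \<le> \<mu> y"
    using conv y unfolding functional_conv_def by blast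
  finally show ?thesis .
qed

text \<open>The filter generated by all strict bounds around \<mu> converges to \<mu>, so it
  eventually lies in each open neighbourhood \<open>U\<close>. Finitely many bounds then already
  force membership in \<open>U\<close>, and \<open>generated_cone_approximation\<close> meets them
  inside the cone.\<close>

lemma in_closure_of_generated_coneI:
  fixes K :: "('a::cu_semigroup \<Rightarrow> ennreal) set"
  assumes K: "K \<subseteq> functionals" and \<mu>: "\<mu> \<in> functionals"
    and dom: "\<And>x y' y. \<forall>l\<in>K. l x \<le> l y' \<Longrightarrow> y' \<lless> y \<Longrightarrow> \<mu> x \<le> \<mu> y"
  shows "\<mu> \<in> functional_topology closure_of generated_cone (K \<union> {\<lambda>_. 0})"
  unfolding in_closure_of topspace_functional_topology
proof (intro conjI allI impI)
  show "\<mu> \<in> functionals" by (rule \<mu>)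
  fix U assume U: "\<mu> \<in> U \<and> openin functional_topology U"
  let ?C = "generated_cone (K \<union> {\<lambda>_. 0})"
  have C: "?C \<subseteq> functionals"
    using K by (intro generated_cone_functionals) (auto simp: functionals_def mono_def)
  \<comment> \<open>An upper bound \<open>s\<close> is imposed at \<open>x'\<close> but comes from
    the value of \<mu> at some \<open>x\<close> with \<open>x' \<lless> x\<close>, matching the
    asymmetry of the convergence.\<close>
  define I where "I = {(x', s) | x' s. \<exists>x. x' \<lless> x \<and> \<mu> x < ennreal s} <+>
    {(y, r). 0 \<le> r \<and> ennreal r < \<mu> y}"
  define G :: "('a \<times> real) + ('a \<times> real) \<Rightarrow> ('a \<Rightarrow> ennreal) set" where
    "G k = (case k of Inl (x', s) \<Rightarrow> {m. m x' < ennreal s} | Inr (y, r) \<Rightarrow> {m. ennreal r < m y})" for k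
  define F where "F = inf (INF k\<in>I. principal (G k)) (principal functionals)"
  have F_I: "\<forall>\<^sub>F m in F. m \<in> G k" if "k \<in> I" for k
    unfolding F_def using that
    by (auto simp: eventually_inf_principal eventually_principal intro: eventually_INF1 eventually_mono)
  have "functional_conv (\<lambda>m. m) \<mu> F"
    unfolding functional_conv_def
  proof (intro allI impI conjI)
    fix x' x :: 'a assume xx: "x' \<lless> x"
    show "Limsup F (\<lambda>m. m x') \<le> \<mu> x"
    proof (rule dense_ge)
      fix z assume "\<mu> x < z"
      then obtain s where s: "\<mu> x < s" "s < z" using dense by blast
      then obtain s' where s': "s = ennreal s'" by (cases s) auto
      have "\<forall>\<^sub>F m in F. m x' < s"
        using F_I[of "Inl (x', s')"] xx s by (auto simp: I_def G_def s')
      then have "Limsup F (\<lambda>m. m x') \<le> s"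
        by (intro Limsup_bounded) (auto elim: eventually_mono)
      then show "Limsup F (\<lambda>m. m x') \<le> z" using s by auto
    qed
    show "\<mu> x \<le> Liminf F (\<lambda>m. m x)"
    proof (rule dense_le)
      fix z assume z: "z < \<mu> x"
      then obtain r where r: "z = ennreal r" "0 \<le> r" by (cases z) auto
      have "\<forall>\<^sub>F m in F. z < m x"
        using F_I[of "Inr (x, r)"] r z by (auto simp: I_def G_def)
      then show "z \<le> Liminf F (\<lambda>m. m x)"
        by (intro Liminf_bounded) (auto elim: eventually_mono)
    qed
  qed
  moreover have "\<forall>\<^sub>F m in F. m \<in> functionals"
    by (simp add: F_def eventually_inf_principal)
  ultimately have "\<forall>\<^sub>F m in F. m \<in> U"
    using U unfolding openin_functional_topology by blast
  \<comment> \<open>An eventual property of an infimum of principal filters holds on the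
    intersection of finitely many of the sets.\<close>
  then obtain X where X: "X \<subseteq> I" "finite X"
    and XU: "\<And>m. \<forall>k\<in>X. m \<in> G k \<Longrightarrow> m \<in> functionals \<Longrightarrow> m \<in> U"
    by (auto simp: F_def eventually_inf_principal eventually_INF[of _ _ I] INF_principal_finite
        eventually_principal)
  define x where "x k = (SOME x. fst k \<lless> x \<and> \<mu> x < ennreal (snd k))" for k :: "'a \<times> real"
  have x: "fst k \<lless> x k \<and> \<mu> (x k) < ennreal (snd k)" if "Inl k \<in> X" for k
    unfolding x_def by (rule someI_ex) (use that X(1) in \<open>force simp: I_def\<close>)
  have "\<exists>\<nu>\<in>?C. (\<forall>k\<in>Inl -` X. \<nu> (fst k) < ennreal (snd k)) \<and>
      (\<forall>k\<in>Inr -` X. ennreal (snd k) < \<nu> (fst k))"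
    using X x by (intro generated_cone_approximation[OF K \<mu> dom, where x = x])
      (auto simp: I_def finite_vimageI)
  then obtain \<nu> where \<nu>: "\<nu> \<in> ?C" "\<And>k. Inl k \<in> X \<Longrightarrow> \<nu> (fst k) < ennreal (snd k)"
    "\<And>k. Inr k \<in> X \<Longrightarrow> ennreal (snd k) < \<nu> (fst k)"
    by blast
  have "\<nu> \<in> G k" if "k \<in> X" for k
    using \<nu>(2,3) that by (cases k) (auto simp: G_def split: prod.split)
  then have "\<nu> \<in> U"
    using XU \<nu>(1) C by blast
  then show "\<exists>m. m \<in> ?C \<and> m \<in> U"
    using \<nu>(1) by blast
qed

section \<open>Equivalence of cone membership, domination and domination with a factor\<close>

theorem theoremA14:
  fixes K :: "('a::cu_semigroup_O5 \<Rightarrow> ennreal) set"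
    and \<mu> :: "'a \<Rightarrow> ennreal"
  assumes "K \<subseteq> functionals"
    and "\<mu> \<in> functionals"
  shows "(\<mu> \<in> functional_topology closure_of generated_cone (K \<union> {\<lambda>_. 0})
      \<longleftrightarrow> (\<forall>x y' y. (\<forall>l\<in>K. l x \<le> l y') \<and> y' \<lless> y \<longrightarrow> \<mu> x \<le> \<mu> y))
    \<and> ((\<forall>x y' y. (\<forall>l\<in>K. l x \<le> l y') \<and> y' \<lless> y \<longrightarrow> \<mu> x \<le> \<mu> y)
      \<longleftrightarrow> (\<forall>x' x y' y. \<forall>\<gamma>::real. 0 < \<gamma> \<and> \<gamma> < 1 \<and> x' \<lless> x
            \<and> (\<forall>l\<in>K. l x \<le> ennreal \<gamma> * l y') \<and> y' \<lless> y \<longrightarrow> \<mu> x' \<le> \<mu> y))"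
proof (intro conjI)
  let ?C = "generated_cone (K \<union> {\<lambda>_. 0})"
  let ?ii = "\<forall>x y' y. (\<forall>l\<in>K. l x \<le> l y') \<and> y' \<lless> y \<longrightarrow> \<mu> x \<le> \<mu> y"
  let ?iii = "\<forall>x' x y' y. \<forall>\<gamma>::real. 0 < \<gamma> \<and> \<gamma> < 1 \<and> x' \<lless> x
            \<and> (\<forall>l\<in>K. l x \<le> ennreal \<gamma> * l y') \<and> y' \<lless> y \<longrightarrow> \<mu> x' \<le> \<mu> y"
  show "\<mu> \<in> functional_topology closure_of ?C \<longleftrightarrow> ?ii"
  proof
    assume cl: "\<mu> \<in> functional_topology closure_of ?C"
    have "\<mu> x \<le> \<mu> y" if "\<forall>l\<in>K. l x \<le> l y'" "y' \<lless> y" for x y' y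
    proof (rule closure_of_le[OF cl _ that(2)])
      show "m x \<le> m y'" if "m \<in> ?C" for m
        using that by (rule generated_cone_le) (use \<open>\<forall>l\<in>K. l x \<le> l y'\<close> in auto)
    qed
    then show ?ii by blast
  next
    assume ?ii
    then show "\<mu> \<in> functional_topology closure_of ?C"
      using assms by (intro in_closure_of_generated_coneI) blast+
  qed
  have multiple: "l (\<Sum>_<n. x) = ennreal n * l x" if "l \<in> functionals" for l and n :: nat and x :: 'a
    using that by (simp add: functional_sum ennreal_of_nat_eq_real_of_nat)
  show "?ii \<longleftrightarrow> ?iii"
  proof
    assume ii: ?ii
    have "\<mu> x' \<le> \<mu> y" if \<gamma>: "0 < \<gamma>" "\<gamma> < 1" and x: "x' \<lless> x"
      and le: "\<forall>l\<in>K. l x \<le> ennreal \<gamma> * l y'" and y: "y' \<lless> y" for x' x y' y and \<gamma> :: real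
    proof -
      have "l x \<le> l y'" if "l \<in> K" for l
      proof -
        have "l x \<le> ennreal \<gamma> * l y'" using le that by blast
        also have "\<dots> \<le> 1 * l y'"
          using \<gamma> by (intro mult_right_mono) auto
        finally show ?thesis by simp
      qed
      then have "\<mu> x \<le> \<mu> y"
        using ii y by blast
      then show ?thesis
        using functional_mono[OF assms(2) way_below_imp_le[OF x]] by (rule order_trans[rotated])
    qed
    then show ?iii by blast
  next
    assume iii: ?iii
    have "\<mu> x \<le> \<mu> y" if le: "\<forall>l\<in>K. l x \<le> l y'" and y: "y' \<lless> y" for x y' y
    proof (cases "\<mu> y")
      case (real d)
      \<comment> \<open>Condition (iii) with \<gamma> equal to \<open>n / (n + 1)\<close> compares
        \<open>n\<close> copies of \<open>x\<close> with \<open>n + 1\<close> copies of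
        \<open>y\<close>; \<open>1 \<le> n\<close> makes \<gamma> positive. It bounds \<mu> at every
        \<open>w\<close> way below the multiple of \<open>x\<close>, and the supremum over
        \<open>w\<close> gives the multiple itself.\<close>
      have bound: "ennreal n * \<mu> x \<le> ennreal (n + 1) * \<mu> y" if n: "1 \<le> n" for n :: nat
      proof -
        have "l (\<Sum>_<n. x) \<le> ennreal (n / (n + 1)) * l (\<Sum>_<n + 1. y')" if l: "l \<in> K" for l
        proof -
          have lf: "l \<in> functionals" using l assms(1) by blast
          have "l (\<Sum>_<n. x) \<le> ennreal n * l y'"
            unfolding multiple[OF lf] using le l by (intro mult_left_mono) auto
          also have "ennreal n = ennreal (n / (n + 1)) * ennreal (n + 1)"
            by (subst ennreal_mult[symmetric]) auto
          finally show ?thesis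
            unfolding multiple[OF lf] by (simp add: mult.assoc)
        qed
        moreover have "(\<Sum>_<n + 1. y') \<lless> (\<Sum>_<n + 1. y)"
          using y by (intro way_below_sum)
        moreover have "0 < real n / (n + 1)" "real n / (n + 1) < 1"
          using n by auto
        ultimately have "\<mu> w \<le> \<mu> (\<Sum>_<n + 1. y)" if "w \<lless> (\<Sum>_<n. x)" for w
          using iii that by blast
        then have "\<mu> (\<Sum>_<n. x) \<le> \<mu> (\<Sum>_<n + 1. y)"
          by (subst functional_eq_SUP_way_below[OF assms(2)]) (auto intro: SUP_least)
        then show ?thesis
          unfolding multiple[OF assms(2)] by simp
      qed
      \<comment> \<open>The case \<open>n = 1\<close> bounds \<mu> at \<open>x\<close> by twice its
        finite value at \<open>y\<close>, so the rest is real arithmetic.\<close>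
      have "\<mu> x \<noteq> \<infinity>"
        using bound[of 1] real by (auto simp: ennreal_mult_eq_top_iff top_unique ennreal_mult[symmetric])
      then obtain e where e: "\<mu> x = ennreal e" "0 \<le> e"
        by (cases "\<mu> x") auto
      have "real n * (e - d) \<le> d" for n
      proof (cases "1 \<le> n")
        case True
        then have "ennreal (n * e) \<le> ennreal ((n + 1) * d)"
          using bound[OF True] e real by (simp add: ennreal_mult)
        then have "n * e \<le> (n + 1) * d"
          using real by (subst (asm) ennreal_le_iff) auto
        then show ?thesis by (simp add: algebra_simps)
      next
        case False
        then have "n = 0" by simp
        then show ?thesis using real by simp
      qed
      then have "e - d \<le> 0"
        by (rule nonpos_if_multiples_bounded)
      then show ?thesis
        using e real by (simp add: ennreal_leI)
    qed simp
    then show ?ii by blast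
  qed
qed

end
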